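(* Let $m,b$ be integers with $m\ge3$ and $b\ge3$, and let $\mathbf t_{b,m}$ be the generalized Thue–Morse word. Then (1) $S(\mathbf t_{b,m})$ is almost $I_2'(m)$-rich; (2) if $m$ is odd or $b$ is odd, then $S(\mathbf t_{b,m})$ is $I_2'(m)$-rich.
   Context: Alphabet $\mathbb Z_m=\{0,\dots,m-1\}$, all letter arithmetic modulo $m$. $\mathbf t_{b,m}=(s_b(n)\bmod m)_{n\ge0}$, where $s_b(n)$ is the sum of the digits of $n$ in base $b$. The map $S$ on (finite nonempty or infinite) words over $\mathbb Z_m$ is $S(w_0w_1w_2\cdots)=v_1v_2\cdots$ with $v_i=(w_{i-1}+w_i)\bmod m$. For $x\in\mathbb Z_m$, $\Psi_x$ is the antimorphism determined by $\Psi_x(k)=x-k$ on letters ($\Psi_x(w_0\cdots w_n)=\Psi_x(w_n)\cdots\Psi_x(w_0)$) and $\Pi_x$ is the morphism with $\Pi_x(k)=x+k$. $I_2'(m)=\{\Psi_{2x}:x\in\mathbb Z_m\}\cup\{\Pi_{2x}:x\in\mathbb Z_m\}$. For a finite group $G$ of morphisms and antimorphisms containing an antimorphism: the orbit of $w$ is $[w]=\{\mu(w):\mu\in G\}$; $p$ is a $G$-palindrome if $\Psi(p)=p$ for some antimorphism $\Psi\in G$; for a finite word $w$, $\mathrm{Pal}^G(w)$ is the set of orbits $[p]$ with $p$ a $G$-palindromic factor of $w$ (the empty word included), $\gamma_G(w)$ is the number of orbits $[a]$ of letters $a$ occurring in $w$ with $a\neq\Psi(a)$ for every antimorphism $\Psi\in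 G$, and $D^G(w)=|w|+1-\#\mathrm{Pal}^G(w)-\gamma_G(w)$. For an infinite word $\mathbf u$, $D^G(\mathbf u)=\sup\{D^G(w): w \text{ a factor of }\mathbf u\}$; $\mathbf u$ is $G$-rich if $D^G(\mathbf u)=0$ and almost $G$-rich if $D^G(\mathbf u)<\infty$. *)

theory Defs
  imports "HOL-Library.Sublist" "HOL-Library.Extended_Real"
begin

text \<open>Finite words over an alphabet \<open>A\<close> are lists in \<open>lists A\<close>, infinite words are functions on
  \<open>nat\<close>. A group of morphisms and antimorphisms is given by its set of elements \<open>G\<close>; its elements
  are only meant to be applied to words over \<open>A\<close>.\<close>

definition antimorphism :: "'a set \<Rightarrow> ('a list \<Rightarrow> 'a list) \<Rightarrow> bool" where
  "antimorphism A \<psi> \<longleftrightarrow>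
     \<psi> ` lists A \<subseteq> lists A \<and> (\<forall>v\<in>lists A. \<forall>w\<in>lists A. \<psi> (v @ w) = \<psi> w @ \<psi> v)"

definition orbit :: "('a list \<Rightarrow> 'a list) set \<Rightarrow> 'a list \<Rightarrow> 'a list set" where
  "orbit G w = {\<mu> w | \<mu>. \<mu> \<in> G}"

definition G_palindrome :: "'a set \<Rightarrow> ('a list \<Rightarrow> 'a list) set \<Rightarrow> 'a list \<Rightarrow> bool" where
  "G_palindrome A G p \<longleftrightarrow> (\<exists>\<psi>\<in>G. antimorphism A \<psi> \<and> \<psi> p = p)"

definition Pal :: "'a set \<Rightarrow> ('a list \<Rightarrow> 'a list) set \<Rightarrow> 'a list \<Rightarrow> 'a list set set" where
  "Pal A G w = {orbit G p | p. sublist p w \<and> G_palindrome A G p}"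

definition letter_defect :: "'a set \<Rightarrow> ('a list \<Rightarrow> 'a list) set \<Rightarrow> 'a list \<Rightarrow> nat" where
  "letter_defect A G w =
     card {orbit G [a] | a. a \<in> set w \<and> (\<forall>\<psi>\<in>G. antimorphism A \<psi> \<longrightarrow> \<psi> [a] \<noteq> [a])}"

definition G_defect :: "'a set \<Rightarrow> ('a list \<Rightarrow> 'a list) set \<Rightarrow> 'a list \<Rightarrow> int" where
  "G_defect A G w = int (length w) + 1 - int (card (Pal A G w)) - int (letter_defect A G w)"

definition factors :: "(nat \<Rightarrow> 'a) \<Rightarrow> 'a list set" where
  "factors u = {map u [i..<j] | i j. i \<le> j}"

definition G_defect_inf :: "'a set \<Rightarrow> ('a list \<Rightarrow> 'a list) set \<Rightarrow> (nat \<Rightarrow> 'a) \<Rightarrow> ereal" where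
  "G_defect_inf A G u = (SUP w\<in>factors u. ereal (real_of_int (G_defect A G w)))"

definition G_rich :: "'a set \<Rightarrow> ('a list \<Rightarrow> 'a list) set \<Rightarrow> (nat \<Rightarrow> 'a) \<Rightarrow> bool" where
  "G_rich A G u \<longleftrightarrow> G_defect_inf A G u = 0"

definition almost_G_rich :: "'a set \<Rightarrow> ('a list \<Rightarrow> 'a list) set \<Rightarrow> (nat \<Rightarrow> 'a) \<Rightarrow> bool" where
  "almost_G_rich A G u \<longleftrightarrow> G_defect_inf A G u < \<infinity>"

text \<open>The alphabet \<open>\<int>\<^sub>m\<close> is represented by \<open>{0..<m}\<close>, with explicit reduction modulo \<open>m\<close>.\<close>

abbreviation Zm :: "int \<Rightarrow> int set" where
  "Zm m \<equiv> {0..<m}"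

text \<open>The guard \<open>b < 2\<close> only ensures termination.\<close>

fun digit_sum :: "nat \<Rightarrow> nat \<Rightarrow> nat" where
  "digit_sum b n = (if n = 0 \<or> b < 2 then 0 else n mod b + digit_sum b (n div b))"

declare digit_sum.simps [simp del]

definition thue_morse :: "nat \<Rightarrow> int \<Rightarrow> nat \<Rightarrow> int" where
  "thue_morse b m n = int (digit_sum b n) mod m"

text \<open>The image of an infinite word is indexed from \<open>0\<close>, so its letter number \<open>i\<close> is the letter
  \<open>v\<^sub>i\<^sub>+\<^sub>1 = w\<^sub>i + w\<^sub>i\<^sub>+\<^sub>1\<close> of the map \<open>S\<close>.\<close>

definition S :: "int \<Rightarrow> (nat \<Rightarrow> int) \<Rightarrow> nat \<Rightarrow> int" where
  "S m w i = (w i + w (Suc i)) mod m"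

definition Psi :: "int \<Rightarrow> int \<Rightarrow> int list \<Rightarrow> int list" where
  "Psi m x w = rev (map (\<lambda>k. (x - k) mod m) w)"

definition Pi_mor :: "int \<Rightarrow> int \<Rightarrow> int list \<Rightarrow> int list" where
  "Pi_mor m x w = map (\<lambda>k. (x + k) mod m) w"

definition I2' :: "int \<Rightarrow> (int list \<Rightarrow> int list) set" where
  "I2' m = {Psi m (2 * x) | x. x \<in> Zm m} \<union> {Pi_mor m (2 * x) | x. x \<in> Zm m}"

end

(* Let d be the word of differences t(i+1) - t(i) mod m. A palindromic factor of d yields a factor of
   S(t) fixed by some Psi_{2x}, and a palindrome of length at least 3 in d can be recovered from the
   orbit so obtained. Since d is a Toeplitz word (d(n-1) depends only on the b-adic valuation of n), it
   is rich in the classical sense: each factor of length n has n + 1 palindromic factors. This bounds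
   the defect of S(t) up to the number of words of length at most 2 over Z_m. If m or b is odd, sums
   of neighbouring letters of S(t) are of the form 2x, so that the orbits of the words of length at
   most 2 make up exactly for the short palindromes of d. *)

theory Submission
  imports Defs "HOL-Number_Theory.Cong"
begin

section \<open>Palindromic factors\<close>

definition pals :: "'a list \<Rightarrow> 'a list set" where
  "pals w = {p. sublist p w \<and> rev p = p}"

lemma finite_sublists: "finite {p. sublist p w}"
  by (metis List.finite_set set_sublists_eq)

lemma finite_pals [simp]: "finite (pals w)"
  unfolding pals_def by (rule finite_subset[OF _ finite_sublists[of w]]) auto

lemma pals_rev: "pals (rev w) = pals w"
  unfolding pals_def by (metis (no_types, lifting) sublist_rev_left sublist_rev_right)

lemma new_palindrome_suffix:
  assumes "p \<in> pals (w @ [a]) - pals w"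
  shows "suffix p (w @ [a])"
  using assms by (auto simp: pals_def sublist_snoc)

text \<open>A palindrome that is a suffix of a palindrome \<open>q\<close> is also a prefix of
  \<open>q\<close>. If it were shorter than \<open>q\<close>, it would end before the last letter
  and so occur in \<open>w\<close> already.\<close>

lemma new_palindrome_unique:
  assumes p: "p \<in> pals (w @ [a]) - pals w" and q: "q \<in> pals (w @ [a]) - pals w"
    and suf: "suffix p q"
  shows "p = q"
proof (rule ccontr)
  assume "p \<noteq> q"
  from p q have [simp]: "rev p = p" "rev q = q" by (auto simp: pals_def)
  from suf have "prefix p q" by (simp add: suffix_to_prefix)
  then obtain z where z: "q = p @ z" by (auto simp: prefix_def)
  with \<open>p \<noteq> q\<close> have "z \<noteq> []" by simp
  from new_palindrome_suffix[OF q] obtain s where "w @ [a] = s @ p @ z"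
    by (auto simp: suffix_def z)
  with \<open>z \<noteq> []\<close> have "w = s @ p @ butlast z"
    by (metis butlast_append butlast_snoc append_is_Nil_conv)
  then show False using p by (auto simp: pals_def)
qed

text \<open>The new palindromes are suffixes, hence comparable, so uniqueness leaves at most one per
  added letter.\<close>

lemma card_pals_snoc: "card (pals (w @ [a])) \<le> Suc (card (pals w))"
proof -
  let ?N = "pals (w @ [a]) - pals w"
  have "p = q" if "p \<in> ?N" "q \<in> ?N" for p q
    using new_palindrome_unique[of p w a q] new_palindrome_unique[of q w a p]
      suffix_same_cases[OF new_palindrome_suffix[OF that(1)] new_palindrome_suffix[OF that(2)]] that
    by blast
  then have "card ?N \<le> 1"
    by (simp add: card_le_Suc0_iff_eq)
  moreover have "card (pals (w @ [a])) \<le> card (pals w) + card ?N"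
    using card_mono[of "pals w \<union> ?N" "pals (w @ [a])"] card_Un_le[of "pals w" ?N] by auto
  ultimately show ?thesis by simp
qed

lemma card_pals_append: "card (pals (v @ w)) \<le> card (pals v) + length w"
proof (induction w rule: rev_induct)
  case (snoc a w)
  then show ?case using card_pals_snoc[of "v @ w" a] by simp
qed simp

text \<open>The classical palindromic defect does not decrease when a word is extended; written
  additively to avoid subtraction. Extensions to the left are turned into extensions to the right by
  reversal. It carries richness from a word to its factors.\<close>

lemma card_pals_sublist:
  assumes "sublist v w"
  shows "card (pals w) + length v \<le> card (pals v) + length w"
proof -
  obtain p s where w: "w = p @ v @ s" using assms by (auto simp: sublist_def)
  have "card (pals w) = card (pals (rev (v @ s) @ rev p))"
    by (metis pals_rev rev_append w)
  also have "\<dots> \<le> card (pals (v @ s)) + length p"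
    using card_pals_append[of "rev (v @ s)" "rev p"] by (simp only: pals_rev length_rev)
  also have "card (pals (v @ s)) \<le> card (pals v) + length s"
    by (rule card_pals_append)
  finally show ?thesis by (simp add: w)
qed

section \<open>Factors and palindromes as index intervals\<close>

lemma sublist_map_uptI:
  assumes "s \<le> i" "i \<le> j" "j \<le> e"
  shows "sublist (map f [i..<j]) (map f [s..<e])"
proof -
  have "[s..<e] = [s..<i] @ [i..<j] @ [j..<e]"
    using assms by (metis le_trans le_add_diff_inverse upt_add_eq_append)
  then show ?thesis by simp
qed

lemma sublist_map_upt:
  "sublist p (map f [s..<e]) \<longleftrightarrow>
     (if s \<le> e then \<exists>i j. s \<le> i \<and> i \<le> j \<and> j \<le> e \<and> p = map f [i..<j] else p = [])"
proof (cases "s \<le> e")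
  case True
  have "\<exists>i j. s \<le> i \<and> i \<le> j \<and> j \<le> e \<and> p = map f [i..<j]" if sl: "sublist p (map f [s..<e])"
  proof -
    obtain x y where xy: "map f [s..<e] = x @ p @ y" using sl by (auto simp: sublist_def)
    then have len: "e - s = length x + length p + length y"
      by (metis length_append length_map length_upt add.assoc)
    have "p = take (length p) (drop (length x) (map f [s..<e]))" by (simp add: xy)
    also have "\<dots> = map f [s + length x..<s + length x + length p]"
      using len True by (simp add: drop_map take_map take_upt)
    finally show ?thesis using len True
      by (intro exI[of _ "s + length x"] exI[of _ "s + length x + length p"]) auto
  qed
  then show ?thesis using True by (auto intro: sublist_map_uptI)
qed simp

lemma rev_map_upt_eq_iff:
  "rev (map f [i..<j]) = map f [i..<j] \<longleftrightarrow> (\<forall>n\<in>{i..<j}. f n = f (i + j - 1 - n))"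
proof -
  have "rev (map f [i..<j]) = map f [i..<j] \<longleftrightarrow> (\<forall>k<j - i. f (j - 1 - k) = f (i + k))"
    by (auto simp: list_eq_iff_nth_eq rev_nth)
  also have "\<dots> \<longleftrightarrow> (\<forall>n\<in>{i..<j}. f n = f (i + j - 1 - n))"
  proof safe
    fix n assume *: "\<forall>k<j - i. f (j - 1 - k) = f (i + k)" and n: "n \<in> {i..<j}"
    then have "n - i < j - i" by auto
    then have f: "f (j - 1 - (n - i)) = f (i + (n - i))"
      using * by blast
    have eq: "j - 1 - (n - i) = i + j - 1 - n" "i + (n - i) = n"
      using n by auto
    show "f n = f (i + j - 1 - n)" using f unfolding eq by (rule sym)
  next
    fix k assume *: "\<forall>n\<in>{i..<j}. f n = f (i + j - 1 - n)" and k: "k < j - i"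
    then have "i + k \<in> {i..<j}" by auto
    then have f: "f (i + k) = f (i + j - 1 - (i + k))"
      by (rule bspec[OF *])
    have eq: "i + j - 1 - (i + k) = j - 1 - k" by simp
    show "f (j - 1 - k) = f (i + k)" using f unfolding eq by (rule sym)
  qed
  finally show ?thesis .
qed

section \<open>Toeplitz sequences are rich\<close>

text \<open>Each palindrome \<open>y\<^sub>1\<dots>y\<^sub>l\<close> of the subsampled word produces the \<open>b\<close> palindromes
  \<open>a\<^sup>r y\<^sub>1 a\<^bsup>b-1\<^esup> y\<^sub>2 \<dots> a\<^bsup>b-1\<^esup> y\<^sub>l a\<^sup>r\<close> with \<open>r < b\<close>. They are distinct unless they are powers of \<open>a\<close>;
  so \<open>(a\<^sup>l, r)\<close> is sent to \<open>a\<^bsup>lb+r\<^esup>\<close> instead.\<close>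

lemma toeplitz_stretch:
  fixes f :: "nat \<Rightarrow> 'a"
  assumes K: "K > 0" and b: "b > 0" and a: "\<And>n. \<not> b dvd n \<Longrightarrow> f n = a"
  shows "b * card (pals (map (\<lambda>n. f (b * n)) [1..<K])) \<le> card (pals (map f [1..<b * K]))"
proof -
  define g where "g n = f (b * n)" for n
  let ?P = "pals (map g [1..<K])"
  have "\<forall>p\<in>?P. \<exists>ij. 1 \<le> fst ij \<and> fst ij \<le> snd ij \<and> snd ij \<le> K \<and> p = map g [fst ij..<snd ij]"
    using K by (auto simp: pals_def sublist_map_upt)
  then obtain ij where ij: "\<And>p. p \<in> ?P \<Longrightarrow> 1 \<le> fst (ij p) \<and> fst (ij p) \<le> snd (ij p) \<and> snd (ij p) \<le> K
      \<and> p = map g [fst (ij p)..<snd (ij p)]"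
    by metis
  define i where "i p = fst (ij p)" for p
  define j where "j p = snd (ij p)" for p
  have ij: "1 \<le> i p" "i p \<le> j p" "j p \<le> K" "map g [i p..<j p] = p" if "p \<in> ?P" for p
    using ij[OF that] by (simp_all add: i_def j_def)
  \<comment> \<open>The letters of \<open>p\<close> sit at the multiples of \<open>b\<close> from
    \<open>b * i p\<close> to \<open>b * (j p - 1)\<close>; the window reaches \<open>r\<close>
    positions beyond them on both sides.\<close>
  define I where "I p r = b * i p - r" for p r
  define J where "J p r = b * (j p - 1) + r + 1" for p r
  define h where "h = (\<lambda>(p, r). if set p \<subseteq> {a} then replicate (length p * b + r) a
     else map f [I p r..<J p r])"
  have less: "i p < j p" if "p \<in> ?P" "\<not> set p \<subseteq> {a}" for p
  proof (rule ccontr)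
    assume "\<not> i p < j p"
    then have "p = []" using ij(4)[OF that(1)] by simp
    with that(2) show False by simp
  qed
  have long: "h (p, r) \<in> pals (map f [1..<b * K])"
    if p: "p \<in> ?P" and r: "r < b" and nc: "\<not> set p \<subseteq> {a}" for p r
  proof -
    obtain i' j' where ij': "i p = Suc i'" "j p = Suc j'" "i' < j'" "Suc j' \<le> K"
      using ij[OF p] less[OF p nc] by (cases "i p"; cases "j p") auto
    have le: "b * i' + b \<le> b * j'" "b * j' + b \<le> b * K"
      using mult_le_mono2[OF ij'(4), of b] mult_le_mono2[OF Suc_leI[OF ij'(3)], of b] by simp_all
    have IJ: "I p r = b * i' + b - r" "J p r = b * j' + r + 1"
      by (simp_all add: I_def J_def ij' algebra_simps)
    have symm: "g q = g (i' + j' + 1 - q)" if "i' < q" "q \<le> j'" for q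
    proof -
      have "rev (map g [i p..<j p]) = map g [i p..<j p]"
        using p unfolding ij(4)[OF p] pals_def by blast
      then show ?thesis using that unfolding rev_map_upt_eq_iff ij' by auto
    qed
    \<comment> \<open>The reflection of the window sends \<open>n\<close> to a multiple of
      \<open>b\<close> minus \<open>n\<close>. It therefore maps multiples of \<open>b\<close> to
      multiples of \<open>b\<close>, mirrored as in \<open>p\<close>, and all other positions, which
      carry \<open>a\<close>, among themselves.\<close>
    have IJ_sum: "I p r + J p r - 1 = b * (i' + j' + 1)"
      using r unfolding IJ distrib_left mult_1_right by linarith
    have "f n = f (I p r + J p r - 1 - n)" if n: "n \<in> {I p r..<J p r}" for n
    proof (cases "b dvd n")
      case True
      then obtain q where q: "n = b * q" by blast
      have "b * i' < b * q" "b * q < b * (j' + 1)"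
        using n r unfolding q IJ atLeastLessThan_iff distrib_left mult_1_right by linarith+
      then have q': "i' < q" "q < j' + 1" by (simp_all only: mult_less_cancel1)
      have "I p r + J p r - 1 - n = b * (i' + j' + 1 - q)"
        by (simp only: IJ_sum q diff_mult_distrib2)
      then show ?thesis using symm[of q] q' by (simp add: q g_def)
    next
      case False
      have "n \<le> I p r + J p r - 1"
        using n r unfolding IJ by simp
      then have "\<not> b dvd (I p r + J p r - 1 - n)"
        using False unfolding IJ_sum by (meson dvd_diffD1 dvd_triv_left)
      with False show ?thesis by (simp add: a)
    qed
    then have "rev (map f [I p r..<J p r]) = map f [I p r..<J p r]"
      by (subst rev_map_upt_eq_iff) blast
    moreover have "1 \<le> I p r" "I p r \<le> J p r" "J p r \<le> b * K"
      using le r unfolding IJ by linarith+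
    then have "sublist (map f [I p r..<J p r]) (map f [1..<b * K])"
      by (rule sublist_map_uptI)
    ultimately show ?thesis using nc by (simp add: h_def pals_def)
  qed
  have short: "h (p, r) \<in> pals (map f [1..<b * K])"
    if p: "p \<in> ?P" and r: "r < b" and c: "set p \<subseteq> {a}" for p r
  proof -
    obtain i' where i': "i p = Suc i'" using ij(1)[OF p] by (cases "i p") auto
    \<comment> \<open>The run starts just after the multiple of \<open>b\<close> preceding the
      occurrence. The multiples of \<open>b\<close> inside it are exactly those that carry letters
      of \<open>p\<close>, and these are all \<open>a\<close>.\<close>
    define s where "s = b * i' + 1"
    have len: "length p = j p - i p" using ij(4)[OF p] by (metis length_map length_upt)
    obtain d where d: "j p = i p + d" using ij(2)[OF p] le_Suc_ex by blast
    have e: "s + (length p * b + r) = b * (j p - 1) + r + 1"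
      unfolding len s_def d i' by (simp add: distrib_left mult.commute)
    have "b * (j p - 1) + b \<le> b * K"
      using ij(1,2,3)[OF p] mult_le_mono2[of "j p" K b] by (cases "j p") auto
    then have "s + (length p * b + r) \<le> b * K"
      using r unfolding e by linarith
    moreover have "f n = a" if n: "n \<in> {s..<s + (length p * b + r)}" for n
    proof (cases "b dvd n")
      case True
      then obtain q where q: "n = b * q" by blast
      have "b * i' < b * q" "b * q < b * (j p - 1 + 1)"
        using n r unfolding e unfolding q atLeastLessThan_iff s_def distrib_left mult_1_right by linarith+
      then have "i p \<le> q" "q < j p" using i' ij(1,2)[OF p] by simp_all
      then have "g q \<in> set p" using ij(4)[OF p] by (metis atLeastLessThan_iff image_eqI set_map set_upt)
      then show ?thesis using c by (auto simp: q g_def)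
    qed (simp add: a)
    then have "map f [s..<s + (length p * b + r)] = replicate (length p * b + r) a"
      by (intro nth_equalityI) auto
    ultimately have "sublist (replicate (length p * b + r) a) (map f [1..<b * K])"
      using sublist_map_uptI[of 1 s "s + (length p * b + r)" "b * K" f] by (simp add: s_def)
    then show ?thesis using c by (simp add: h_def pals_def)
  qed
  have len: "J p r - I p r = (length p - 1) * b + 2 * r + 1" "p \<noteq> []"
    if p: "p \<in> ?P" and r: "r < b" and nc: "\<not> set p \<subseteq> {a}" for p r
  proof -
    have "length p = j p - i p" using ij(4)[OF p] by (metis length_map length_upt)
    moreover obtain c where c: "i p = Suc c" using ij(1)[OF p] by (cases "i p") auto
    moreover obtain d where "j p = Suc (i p + d)" using less[OF p nc] by (metis less_imp_Suc_add)
    ultimately have *: "i p = Suc c" "j p = Suc (Suc (c + d))" "length p = Suc d" by simp_all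
    from * r show "J p r - I p r = (length p - 1) * b + 2 * r + 1"
      unfolding I_def J_def by (simp add: algebra_simps)
    show "p \<noteq> []" using *(3) by auto
  qed
  \<comment> \<open>The residue \<open>r\<close> modulo \<open>b\<close> marks where
    \<open>p\<close> can be read off, which is what makes \<open>h\<close> injective on words that
    are not powers of \<open>a\<close>.\<close>
  have entry: "h (p, r) ! k = (if k mod b = r then p ! (k div b) else a)"
    if p: "p \<in> ?P" and r: "r < b" and nc: "\<not> set p \<subseteq> {a}" and k: "k < J p r - I p r" for p r k
  proof -
    have I: "I p r + k + r = b * i p + k"
      using r ij(1)[OF p] by (cases "i p") (auto simp: I_def)
    have h: "h (p, r) ! k = f (I p r + k)" using k nc by (simp add: h_def)
    show ?thesis
    proof (cases "k mod b = r")
      case True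
      then have "k = b * (k div b) + r" by (metis mult_div_mod_eq)
      then have eq: "I p r + k = b * (i p + k div b)" using I by (simp add: algebra_simps)
      have "b * (k div b) + r < (length p - 1) * b + 2 * r + 1"
        using k \<open>k = _\<close> len(1)[OF p r nc] by metis
      then have "b * (k div b) < b * length p"
        using r len(2)[OF p r nc] by (cases p) (simp_all add: algebra_simps)
      then have "k div b < length p" by simp
      moreover have "length p = j p - i p" using ij(4)[OF p] by (metis length_map length_upt)
      ultimately have "p ! (k div b) = g (i p + k div b)"
        using ij(4)[OF p] by (metis nth_map_upt)
      then show ?thesis using True by (simp add: h eq g_def)
    next
      case False
      then have "\<not> b dvd (I p r + k)"
        using I r by (metis add_0 dvd_imp_mod_0 mod_add_left_eq mod_less mod_mult_self4)
      then show ?thesis using False by (simp add: h a)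
    qed
  qed
  have lenh: "length (h (p, r)) = (length p - 1) * b + 2 * r + 1"
    if p: "p \<in> ?P" and r: "r < b" and nc: "\<not> set p \<subseteq> {a}" for p r
    using len(1)[OF that] nc by (simp add: h_def)
  have pos: "b * t + r < (length p - 1) * b + 2 * r + 1" if "t < length p" for p :: "'a list" and t r
  proof -
    have "b * t \<le> b * (length p - 1)" using that by (intro mult_le_mono2) simp
    then show ?thesis by (simp add: algebra_simps)
  qed
  have nth_h: "h (p, r) ! (b * t + r) = p ! t" if p: "p \<in> ?P" and r: "r < b" and nc: "\<not> set p \<subseteq> {a}"
    and t: "t < length p" for p r t
    using entry[OF p r nc, of "b * t + r"] len(1)[OF p r nc] pos[OF t, of r] r b by simp
  have nonconst: "\<not> set (h (p, r)) \<subseteq> {a}" if p: "p \<in> ?P" and r: "r < b" and nc: "\<not> set p \<subseteq> {a}" for p r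
  proof -
    obtain t where t: "t < length p" "p ! t \<noteq> a"
      using nc by (metis in_set_conv_nth insertI1 subsetI)
    have "b * t + r < length (h (p, r))" using lenh[OF p r nc] pos[OF t(1)] by simp
    then have "p ! t \<in> set (h (p, r))" using nth_h[OF p r nc t(1)] by (metis nth_mem)
    then show ?thesis using t(2) by auto
  qed
  have const: "set (h (p, r)) \<subseteq> {a}" if "set p \<subseteq> {a}" for p r
    using that by (auto simp: h_def)
  have "p = p' \<and> r = r'" if p: "p \<in> ?P" and r: "r < b" and p': "p' \<in> ?P" and r': "r' < b"
    and eq: "h (p, r) = h (p', r')" for p r p' r'
  proof -
    consider "set p \<subseteq> {a}" "set p' \<subseteq> {a}" | "\<not> set p \<subseteq> {a}" "\<not> set p' \<subseteq> {a}"
      | "set p \<subseteq> {a}" "\<not> set p' \<subseteq> {a}" | "\<not> set p \<subseteq> {a}" "set p' \<subseteq> {a}" by blast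
    then show ?thesis
    proof cases
      case 1
      then have "length p * b + r = length p' * b + r'"
        using eq by (simp add: h_def)
      \<comment> \<open>Length and offset are the quotient and the remainder of the exponent of
        \<open>a\<close> modulo \<open>b\<close>.\<close>
      moreover have "(length q * b + s) mod b = s" "(length q * b + s) div b = length q" if "s < b" for q :: "'a list" and s
        using that by simp_all
      ultimately have "r = r'" "length p = length p'"
        using r r' by metis+
      moreover have "q = replicate (length q) a" if "set q \<subseteq> {a}" for q
        using that by (auto intro: replicate_eqI)
      ultimately show ?thesis using 1 by metis
    next
      case 2
      \<comment> \<open>With two different offsets, each position misses one of the two residue
        classes and so carries \<open>a\<close>; the word would be a power of
        \<open>a\<close>.\<close>
      have rr: "r = r'"
      proof (rule ccontr)
        assume "r \<noteq> r'"
        have "h (p, r) ! k = a" if "k < length (h (p, r))" for k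
        proof (cases "k mod b = r")
          case True
          then show ?thesis using \<open>r \<noteq> r'\<close> entry[OF p' r' 2(2), of k] that lenh[OF p' r' 2(2)] len(1)[OF p' r' 2(2)]
            by (simp add: eq)
        next
          case False
          then show ?thesis using entry[OF p r 2(1), of k] that lenh[OF p r 2(1)] len(1)[OF p r 2(1)]
            by simp
        qed
        then show False using nonconst[OF p r 2(1)] by (auto simp: in_set_conv_nth)
      qed
      have "(length p - 1) * b + 2 * r + 1 = (length p' - 1) * b + 2 * r' + 1"
        using arg_cong[OF eq, of length] unfolding lenh[OF p r 2(1)] lenh[OF p' r' 2(2)] .
      then have "length p - 1 = length p' - 1"
        using rr b by simp
      then have l: "length p = length p'"
        using b len(2)[OF p r 2(1)] len(2)[OF p' r' 2(2)] by (cases p; cases p') auto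
      have "p ! t = p' ! t" if "t < length p" for t
        using nth_h[OF p r 2(1) that] nth_h[OF p' r' 2(2), of t] that l eq rr by simp
      then show ?thesis using l rr by (auto intro: nth_equalityI)
    next
      case 3
      then show ?thesis using nonconst[OF p' r'] const[of p r] eq by metis
    next
      case 4
      then show ?thesis using nonconst[OF p r] const[of p' r'] eq by metis
    qed
  qed
  then have "inj_on h (?P \<times> {..<b})"
    by (auto simp: inj_on_def)
  moreover have "h ` (?P \<times> {..<b}) \<subseteq> pals (map f [1..<b * K])"
    using long short by blast
  ultimately have "card (?P \<times> {..<b}) \<le> card (pals (map f [1..<b * K]))"
    by (rule card_inj_on_le) simp
  then show ?thesis by (simp add: card_cartesian_product g_def[abs_def] mult.commute)
qed

text \<open>The subsampled sequence \<open>f (b * n)\<close> has the same Toeplitz property, so each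
  stretching step multiplies the bound by \<open>b\<close>. The prefix has length
  \<open>b ^ k - 1\<close>, so \<open>b ^ k\<close> is the count required for richness.\<close>

lemma toeplitz_prefix_rich:
  fixes f :: "nat \<Rightarrow> 'a"
  assumes b: "b > 0" and f: "\<And>j n. \<not> b dvd n \<Longrightarrow> f (b ^ j * n) = f (b ^ j)"
  shows "b ^ k \<le> card (pals (map f [1..<b ^ k]))"
  using f
proof (induction k arbitrary: f)
  case 0
  have "pals [] = {[] :: 'a list}" by (auto simp: pals_def)
  then show ?case by simp
next
  case (Suc k)
  have "f (b * (b ^ j * n)) = f (b * b ^ j)" if "\<not> b dvd n" for j n
    using Suc.prems[OF that, of "Suc j"] by (simp add: mult.assoc)
  then have "b ^ k \<le> card (pals (map (\<lambda>n. f (b * n)) [1..<b ^ k]))"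
    by (rule Suc.IH)
  then have "b ^ Suc k \<le> b * card (pals (map (\<lambda>n. f (b * n)) [1..<b ^ k]))"
    by simp
  also have "\<dots> \<le> card (pals (map f [1..<b * b ^ k]))"
    using Suc.prems[of _ 0] b by (intro toeplitz_stretch[where a = "f 1"]) auto
  finally show ?case by simp
qed

text \<open>Each factor lies in a rich prefix of length \<open>b ^ j - 1\<close>, and factors of
  rich words are rich.\<close>

lemma toeplitz_rich:
  fixes f :: "nat \<Rightarrow> 'a"
  assumes b: "b \<ge> 2" and f: "\<And>j n. \<not> b dvd n \<Longrightarrow> f (b ^ j * n) = f (b ^ j)"
    and ij: "1 \<le> i" "i \<le> j"
  shows "j - i + 1 \<le> card (pals (map f [i..<j]))"
proof -
  have "j < b ^ j" using b by (intro power_gt_expt) simp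
  then have "sublist (map f [i..<j]) (map f [1..<b ^ j])"
    using ij by (intro sublist_map_uptI) auto
  from card_pals_sublist[OF this] toeplitz_prefix_rich[of b f j] b f \<open>j < b ^ j\<close>
  show ?thesis by simp
qed

section \<open>Orbits of factors of \<open>S t\<close>\<close>

lemma antimorphism_Psi: "m > 0 \<Longrightarrow> antimorphism (Zm m) (Psi m x)"
  by (auto simp: antimorphism_def Psi_def)

text \<open>Reduction modulo \<open>m\<close> of the parameter allows arbitrary integers, such as
  \<open>t i + t j\<close>, as witnesses.\<close>

lemma Psi_in_I2':
  assumes "m > 0"
  shows "Psi m (2 * x) \<in> I2' m"
proof -
  have "(2 * x - k) mod m = (2 * (x mod m) - k) mod m" for k
    by (metis mod_diff_left_eq mod_mult_right_eq)
  then have "Psi m (2 * x) = Psi m (2 * (x mod m))"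
    by (simp add: Psi_def fun_eq_iff)
  then show ?thesis using assms by (auto simp: I2'_def intro!: exI[of _ "x mod m"])
qed

lemma G_palindromeI: "m > 0 \<Longrightarrow> Psi m (2 * x) p = p \<Longrightarrow> G_palindrome (Zm m) (I2' m) p"
  using antimorphism_Psi Psi_in_I2' by (force simp: G_palindrome_def)

lemma self_in_orbit:
  assumes "m > 0" "set q \<subseteq> Zm m"
  shows "q \<in> orbit (I2' m) q"
proof -
  have "Pi_mor m (2 * 0) q = q"
    using assms by (auto simp: Pi_mor_def intro!: map_idI)
  moreover have "Pi_mor m (2 * 0) \<in> I2' m"
    using assms by (force simp: I2'_def)
  ultimately show ?thesis unfolding orbit_def mem_Collect_eq by metis
qed

text \<open>On words fixed by some \<open>\<Psi>\<^sub>y\<close> each antimorphism acts like a translation,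
  as \<open>\<Psi>\<^sub>x \<circ> \<Psi>\<^sub>y = \<Pi>\<^bsub>x - y\<^esub>\<close>.\<close>

lemma orbit_palindrome_shift:
  assumes q: "Psi m y q = q" and q': "q' \<in> orbit (I2' m) q"
  shows "\<exists>c. q' = map (\<lambda>k. (c + k) mod m) q"
proof -
  consider x where "q' = Psi m x q" | x where "q' = Pi_mor m x q"
    using q' by (auto simp: orbit_def I2'_def)
  then show ?thesis
  proof cases
    case 1
    have "q' = Psi m x (Psi m y q)" using 1 q by simp
    also have "\<dots> = map (\<lambda>k. (x - y + k) mod m) q"
      by (simp add: Psi_def rev_map mod_simps algebra_simps)
    finally show ?thesis by blast
  qed (auto simp: Pi_mor_def)
qed

lemma finite_Pal: "finite (Pal A G w)"
proof -
  have "Pal A G w \<subseteq> orbit G ` {p. sublist p w}" by (auto simp: Pal_def)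
  then show ?thesis by (rule finite_subset) (simp add: finite_sublists)
qed

text \<open>The orbit of a word fixed by some \<open>Psi\<close> consists of translates of it, so
  such words lie in different orbits as soon as none is a translate of another.\<close>

lemma card_Pal_ge:
  assumes m: "m > 0" and w: "set w \<subseteq> Zm m"
    and pal: "\<And>q. q \<in> X \<Longrightarrow> sublist q w \<and> (\<exists>x. Psi m (2 * x) q = q)"
    and inequiv: "\<And>q q' c. q \<in> X \<Longrightarrow> q' \<in> X \<Longrightarrow> q' = map (\<lambda>k. (c + k) mod m) q \<Longrightarrow> q = q'"
  shows "card X \<le> card (Pal (Zm m) (I2' m) w)"
proof (rule card_inj_on_le[OF _ _ finite_Pal])
  show "inj_on (orbit (I2' m)) X"
  proof (rule inj_onI)
    fix q q' assume X: "q \<in> X" "q' \<in> X" and eq: "orbit (I2' m) q = orbit (I2' m) q'"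
    have "set q' \<subseteq> Zm m" using pal[OF X(2)] w set_mono_sublist by blast
    then have "q' \<in> orbit (I2' m) q" using self_in_orbit[OF m] eq by simp
    then obtain c where "q' = map (\<lambda>k. (c + k) mod m) q"
      using orbit_palindrome_shift pal[OF X(1)] by metis
    then show "q = q'" by (rule inequiv[OF X])
  qed
  show "orbit (I2' m) ` X \<subseteq> Pal (Zm m) (I2' m) w"
    using pal G_palindromeI[OF m] by (force simp: Pal_def)
qed

section \<open>The difference word and its relation to \<open>S t\<close>\<close>

definition diff :: "int \<Rightarrow> (nat \<Rightarrow> int) \<Rightarrow> nat \<Rightarrow> int" where
  "diff m t i = (t (Suc i) - t i) mod m"

lemma Psi_map_upt:
  assumes "\<And>n. n \<in> {i..<j} \<Longrightarrow> [u n + u (i + j - 1 - n) = y] (mod m)"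
    and "\<And>n. u n \<in> Zm m"
  shows "Psi m y (map u [i..<j]) = map u [i..<j]"
proof (rule nth_equalityI)
  fix k assume "k < length (Psi m y (map u [i..<j]))"
  then have k: "k < j - i" by (simp add: Psi_def)
  then have "Psi m y (map u [i..<j]) ! k = (y - u (i + j - 1 - (i + k))) mod m"
    by (simp add: Psi_def rev_nth)
  also have "\<dots> = u (i + k) mod m"
    using assms(1)[of "i + k"] k by (auto simp: cong_iff_dvd_diff mod_eq_dvd_iff algebra_simps dvd_diff_commute)
  finally show "Psi m y (map u [i..<j]) ! k = map u [i..<j] ! k"
    using assms(2)[of "i + k"] k by simp
qed (simp add: Psi_def)

text \<open>Moving inwards from both ends, the left value gains a difference and the right value
  loses its mirror image. In a palindrome these are equal, so the sum stays constant.\<close>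

lemma diff_palindrome_sum:
  assumes "rev (map (diff m t) [i..<j]) = map (diff m t) [i..<j]" and "k \<le> j - i" and "i \<le> j"
  shows "[t (i + k) + t (j - k) = t i + t j] (mod m)"
  using assms(2)
proof (induction k)
  case (Suc k)
  have "diff m t (i + k) = diff m t (i + j - 1 - (i + k))"
  proof (rule bspec[OF assms(1)[unfolded rev_map_upt_eq_iff]])
    show "i + k \<in> {i..<j}" using Suc.prems by auto
  qed
  moreover have "i + j - 1 - (i + k) = j - Suc k" "Suc (j - Suc k) = j - k"
    using Suc.prems assms(3) by simp_all
  ultimately have d: "[t (Suc (i + k)) - t (i + k) = t (j - k) - t (j - Suc k)] (mod m)"
    by (simp add: diff_def cong_def)
  have "[t (i + k) + t (j - k) = t i + t j] (mod m)"
    using Suc by simp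
  from cong_add[OF cong_add[OF d this] cong_refl]
  have "[(t (Suc (i + k)) - t (i + k)) + (t (i + k) + t (j - k)) + (t (j - Suc k) - t (j - k))
      = (t (j - k) - t (j - Suc k)) + (t i + t j) + (t (j - Suc k) - t (j - k))] (mod m)"
    .
  then show ?case by simp
qed simp

lemma S_cong: "[S m t n = t n + t (Suc n)] (mod m)"
  by (simp add: S_def cong_def)

text \<open>A letter of \<open>S t\<close> and its mirror image together contain two symmetric pairs
  of values of \<open>t\<close>, each with sum \<open>t i + t j\<close>. This is where the factor 2
  in the parameters of \<open>I2'\<close> comes from.\<close>

lemma S_palindrome:
  assumes m: "m > 0" and ij: "i \<le> j"
    and pal: "rev (map (diff m t) [i..<j]) = map (diff m t) [i..<j]"
  shows "Psi m (2 * (t i + t j)) (map (S m t) [i..<j]) = map (S m t) [i..<j]"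
proof (rule Psi_map_upt)
  fix n assume n: "n \<in> {i..<j}"
  have e: "Suc (j - Suc (n - i)) = j - (n - i)" "i + j - 1 - n = j - Suc (n - i)" using n by auto
  have "[t n + t (j - (n - i)) = t i + t j] (mod m)"
    using diff_palindrome_sum[OF pal _ ij, of "n - i"] n diff_le_mono[of n j i] by simp
  moreover have "[t (Suc n) + t (j - Suc (n - i)) = t i + t j] (mod m)"
    using diff_palindrome_sum[OF pal _ ij, of "Suc (n - i)"] n Suc_diff_le[of i n] Suc_leI[OF diff_less_mono[of n j i]] by simp
  ultimately have "[(t n + t (j - (n - i))) + (t (Suc n) + t (j - Suc (n - i))) = 2 * (t i + t j)] (mod m)"
    unfolding mult_2 by (rule cong_add)
  moreover have "[S m t n + S m t (i + j - 1 - n)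
      = (t n + t (Suc n)) + (t (j - Suc (n - i)) + t (j - (n - i)))] (mod m)"
    using cong_add[OF S_cong[of m t n] S_cong[of m t "j - Suc (n - i)"]] unfolding e(1) e(2) .
  moreover have "(t n + t (Suc n)) + (t (j - Suc (n - i)) + t (j - (n - i)))
      = (t n + t (j - (n - i))) + (t (Suc n) + t (j - Suc (n - i)))"
    by simp
  ultimately show "[S m t n + S m t (i + j - 1 - n) = 2 * (t i + t j)] (mod m)"
    by (metis cong_trans)
qed (use m in \<open>simp add: S_def\<close>)


lemma S_Suc_cong: "[S m t (Suc n) - S m t n = diff m t n + diff m t (Suc n)] (mod m)"
proof -
  have "[S m t (Suc n) - S m t n = (t (Suc n) + t (Suc (Suc n))) - (t n + t (Suc n))] (mod m)"
    by (intro cong_diff S_cong)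
  moreover have "[diff m t n + diff m t (Suc n) = (t (Suc n) - t n) + (t (Suc (Suc n)) - t (Suc n))] (mod m)"
    by (intro cong_add) (simp_all add: diff_def cong_def)
  ultimately show ?thesis by (simp add: cong_def)
qed

text \<open>The constant \<open>c\<close> cancels in differences of neighbouring letters of
  \<open>S t\<close>, and these are sums of neighbouring entries of \<open>diff m t\<close>. Such
  sums are therefore invariant under translation.\<close>

lemma shift_diff_sums:
  assumes "map (S m t) [i'..<i' + l] = map (\<lambda>k. (c + k) mod m) (map (S m t) [i..<i + l])"
    and k: "Suc k < l"
  shows "[diff m t (i' + k) + diff m t (Suc (i' + k)) = diff m t (i + k) + diff m t (Suc (i + k))] (mod m)"
proof -
  have S: "[S m t (i' + k) = c + S m t (i + k)] (mod m)" if "k < l" for k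
  proof -
    have "map (S m t) [i'..<i' + l] ! k = map (\<lambda>k. (c + k) mod m) (map (S m t) [i..<i + l]) ! k"
      using assms(1) by simp
    with that show ?thesis by (simp add: cong_def)
  qed
  have "[S m t (i' + Suc k) - S m t (i' + k) = (c + S m t (i + Suc k)) - (c + S m t (i + k))] (mod m)"
    using k by (intro cong_diff S) simp_all
  then have "[S m t (Suc (i' + k)) - S m t (i' + k) = S m t (Suc (i + k)) - S m t (i + k)] (mod m)"
    by simp
  then show ?thesis
    using S_Suc_cong[of m t "i' + k"] S_Suc_cong[of m t "i + k"] by (meson cong_sym cong_trans)
qed

text \<open>Neighbouring sums determine a word up to an alternating error. In every window of length three
  at least two differences are 1, so two such windows agree somewhere and the error vanishes.\<close>

lemma shift_diff_eq:
  assumes m: "m > 0" and one: "\<And>n. diff m t n = 1 \<or> diff m t (Suc n) = 1"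
      "\<And>n. diff m t n = 1 \<or> diff m t (Suc (Suc n)) = 1"
    and shift: "map (S m t) [i'..<i' + l] = map (\<lambda>k. (c + k) mod m) (map (S m t) [i..<i + l])"
    and l: "l \<ge> 3" and k: "k < l"
  shows "diff m t (i' + k) = diff m t (i + k)"
proof -
  let ?P = "\<lambda>k. diff m t (i' + k) = diff m t (i + k)"
  have red: "diff m t n mod m = diff m t n" for n by (simp add: diff_def)
  have step: "?P k \<longleftrightarrow> ?P (Suc k)" if "Suc k < l" for k
  proof -
    have sums: "[diff m t (i' + k) + diff m t (i' + Suc k) = diff m t (i + k) + diff m t (i + Suc k)] (mod m)"
      using shift_diff_sums[OF shift that] by simp
    have "[diff m t (i' + Suc k) = diff m t (i + Suc k)] (mod m)" if "?P k"
      using sums unfolding that cong_add_lcancel .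
    moreover have "[diff m t (i' + k) = diff m t (i + k)] (mod m)" if "?P (Suc k)"
      using sums unfolding that cong_add_rcancel .
    ultimately show ?thesis unfolding cong_def red by blast
  qed
  have "?P 0 \<or> ?P (Suc 0) \<or> ?P (Suc (Suc 0))"
    using one[of i] one[of i'] one(1)[of "Suc i"] one(1)[of "Suc i'"] by auto
  moreover have "?P 0 \<longleftrightarrow> ?P (Suc 0)" "?P (Suc 0) \<longleftrightarrow> ?P (Suc (Suc 0))"
    using l by (intro step; simp)+
  ultimately have "?P 0" by blast
  with k show ?thesis
  proof (induction k)
    case (Suc k)
    then show ?case using step[of k] by simp
  qed
qed

section \<open>Counting orbits and bounding the defect\<close>

lemma chosen_positions:
  assumes "s \<le> e"
  obtains i j where "\<And>p. p \<in> pals (map f [s..<e]) \<Longrightarrow>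
    s \<le> i p \<and> i p \<le> j p \<and> j p \<le> e \<and> p = map f [i p..<j p]"
proof -
  have "\<forall>p\<in>pals (map f [s..<e]). \<exists>i j. s \<le> i \<and> i \<le> j \<and> j \<le> e \<and> p = map f [i..<j]"
    using assms by (auto simp: pals_def sublist_map_upt)
  then show thesis using that by metis
qed

definition long_pals :: "'a list \<Rightarrow> 'a list set" where
  "long_pals w = {p \<in> pals w. 3 \<le> length p}"

text \<open>At a chosen occurrence of each long palindrome of the difference word, the factor of
  \<open>S t\<close> is taken. By \<open>shift_diff_eq\<close> its translation class determines the
  palindrome; the threshold 3 is the window length used there.\<close>

lemma long_palindrome_representatives:
  assumes m: "m > 0" and one: "\<And>n. diff m t n = 1 \<or> diff m t (Suc n) = 1"
      "\<And>n. diff m t n = 1 \<or> diff m t (Suc (Suc n)) = 1" and se: "s \<le> e"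
  obtains X where "finite X" "card X = card (long_pals (map (diff m t) [s..<e]))"
    "\<And>q. q \<in> X \<Longrightarrow> sublist q (map (S m t) [s..<e]) \<and> (\<exists>x. Psi m (2 * x) q = q)"
    "\<And>q. q \<in> X \<Longrightarrow> 3 \<le> length q"
    "\<And>q q' c. q \<in> X \<Longrightarrow> q' \<in> X \<Longrightarrow> q' = map (\<lambda>k. (c + k) mod m) q \<Longrightarrow> q = q'"
proof -
  let ?L = "long_pals (map (diff m t) [s..<e])"
  obtain i j where ij: "\<And>p. p \<in> pals (map (diff m t) [s..<e]) \<Longrightarrow>
    s \<le> i p \<and> i p \<le> j p \<and> j p \<le> e \<and> p = map (diff m t) [i p..<j p]"
    using chosen_positions[OF se, of "diff m t"] by metis
  have L: "s \<le> i p" "i p \<le> j p" "j p \<le> e" "map (diff m t) [i p..<j p] = p" "rev p = p" "3 \<le> length p"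
    "j p = i p + length p" if "p \<in> ?L" for p
  proof -
    have p: "p \<in> pals (map (diff m t) [s..<e])" "3 \<le> length p" using that by (auto simp: long_pals_def)
    show "s \<le> i p" "i p \<le> j p" "j p \<le> e" "map (diff m t) [i p..<j p] = p"
      using ij[OF p(1)] by simp_all
    then show "j p = i p + length p" by (metis le_add_diff_inverse length_map length_upt)
    show "rev p = p" "3 \<le> length p" using p by (auto simp: pals_def)
  qed
  define h where "h p = map (S m t) [i p..<j p]" for p
  have inj: "p = p'" if p: "p \<in> ?L" and p': "p' \<in> ?L" and shift: "h p' = map (\<lambda>k. (c + k) mod m) (h p)" for p p' c
  proof -
    have l: "length p' = length p"
      using arg_cong[OF shift, of length] L(7)[OF p] L(7)[OF p'] by (simp add: h_def)
    have "diff m t (i p' + k) = diff m t (i p + k)" if k: "k < length p" for k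
    proof (rule shift_diff_eq[OF m one _ L(6)[OF p] k])
      show "map (S m t) [i p'..<i p' + length p] = map (\<lambda>k. (c + k) mod m) (map (S m t) [i p..<i p + length p])"
        using shift L(7)[OF p] L(7)[OF p'] l by (simp add: h_def)
    qed
    then have "map (diff m t) [i p'..<j p'] = map (diff m t) [i p..<j p]"
      using l L(7)[OF p] L(7)[OF p'] by (intro nth_equalityI) auto
    then show ?thesis using L(4)[OF p] L(4)[OF p'] by simp
  qed
  \<comment> \<open>Equality is translation by 0, so injectivity of \<open>h\<close> is a special
    case of \<open>inj\<close>.\<close>
  have id: "h p = map (\<lambda>k. (0 + k) mod m) (h p)" for p
    by (simp add: h_def S_def)
  have "inj_on h ?L"
    by (rule inj_onI) (metis inj id)
  show thesis
  proof (rule that[of "h ` ?L"])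
    show "finite (h ` ?L)" by (simp add: long_pals_def)
    show "card (h ` ?L) = card ?L" using \<open>inj_on h ?L\<close> by (rule card_image)
    show "sublist q (map (S m t) [s..<e]) \<and> (\<exists>x. Psi m (2 * x) q = q)" if q: "q \<in> h ` ?L" for q
    proof -
      obtain p where p: "p \<in> ?L" "q = h p" using q by blast
      have "sublist q (map (S m t) [s..<e])"
        unfolding p(2) h_def using L(1,2,3)[OF p(1)] by (rule sublist_map_uptI)
      moreover have "Psi m (2 * (t (i p) + t (j p))) q = q"
        unfolding p(2) h_def by (rule S_palindrome[OF m L(2)[OF p(1)]]) (simp add: L(4,5)[OF p(1)])
      ultimately show ?thesis by blast
    qed
    show "3 \<le> length q" if "q \<in> h ` ?L" for q
      using that L(6,7) by (auto simp: h_def)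
    show "q = q'" if q: "q \<in> h ` ?L" "q' \<in> h ` ?L" "q' = map (\<lambda>k. (c + k) mod m) q" for q q' c
    proof -
      obtain p p' where "p \<in> ?L" "p' \<in> ?L" "q = h p" "q' = h p'" using q by blast
      with inj[of p p' c] q(3) show ?thesis by simp
    qed
  qed
qed

lemma S_in_Zm: "m > 0 \<Longrightarrow> set (map (S m t) xs) \<subseteq> Zm m"
  by (auto simp: S_def)

text \<open>Only the palindromes of length at most 2 in the difference word may lack a counterpart,
  and the bound is the number of all such words.\<close>

lemma S_defect_bounded:
  assumes m: "m > 0" and one: "\<And>n. diff m t n = 1 \<or> diff m t (Suc n) = 1"
      "\<And>n. diff m t n = 1 \<or> diff m t (Suc (Suc n)) = 1" and se: "s \<le> e"
    and rich: "e - s + 1 \<le> card (pals (map (diff m t) [s..<e]))"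
  shows "G_defect (Zm m) (I2' m) (map (S m t) [s..<e]) \<le> int (card {p. set p \<subseteq> Zm m \<and> length p \<le> 2})"
proof -
  let ?d = "map (diff m t) [s..<e]" and ?C = "{p. set p \<subseteq> Zm m \<and> length p \<le> 2}"
  obtain X where X: "finite X" "card X = card (long_pals ?d)"
    "\<And>q. q \<in> X \<Longrightarrow> sublist q (map (S m t) [s..<e]) \<and> (\<exists>x. Psi m (2 * x) q = q)"
    "\<And>q q' c. q \<in> X \<Longrightarrow> q' \<in> X \<Longrightarrow> q' = map (\<lambda>k. (c + k) mod m) q \<Longrightarrow> q = q'"
    using long_palindrome_representatives[OF m one se] by metis
  have "card X \<le> card (Pal (Zm m) (I2' m) (map (S m t) [s..<e]))"
    using card_Pal_ge[OF m S_in_Zm[OF m] X(3,4)] .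
  moreover have fin: "finite ?C" by (intro finite_lists_length_le) simp
  have "set p \<subseteq> Zm m" if "p \<in> pals ?d" for p
  proof -
    have "set p \<subseteq> set ?d" using that set_mono_sublist[of p ?d] by (simp add: pals_def)
    also have "\<dots> \<subseteq> Zm m" using m by (auto simp: diff_def)
    finally show ?thesis .
  qed
  then have "pals ?d \<subseteq> long_pals ?d \<union> ?C" by (auto simp: long_pals_def)
  then have "card (pals ?d) \<le> card (long_pals ?d) + card ?C"
    using fin card_Un_le[of "long_pals ?d" ?C] card_mono[of "long_pals ?d \<union> ?C" "pals ?d"]
    by (simp add: long_pals_def)
  ultimately show ?thesis using rich X(2) se by (simp add: G_defect_def)
qed

text \<open>By \<open>even\<close>, all two-letter factors of \<open>S t\<close> are fixed by some
  \<open>Psi m (2 * x)\<close>. Their orbits, with those of the empty word and of one letter,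
  compensate for all short palindromes of the difference word.\<close>

lemma S_defect_nonpos:
  assumes m: "m > 0" and one: "\<And>n. diff m t n = 1 \<or> diff m t (Suc n) = 1"
      "\<And>n. diff m t n = 1 \<or> diff m t (Suc (Suc n)) = 1" and se: "s < e"
    and rich: "e - s + 1 \<le> card (pals (map (diff m t) [s..<e]))"
    and even: "\<And>n. \<exists>x. [2 * x = S m t n + S m t (Suc n)] (mod m)"
  shows "G_defect (Zm m) (I2' m) (map (S m t) [s..<e]) \<le> 0"
proof -
  let ?d = "map (diff m t) [s..<e]" and ?u = "map (S m t) [s..<e]"
  obtain X where X: "finite X" "card X = card (long_pals ?d)"
    "\<And>q. q \<in> X \<Longrightarrow> sublist q ?u \<and> (\<exists>x. Psi m (2 * x) q = q)"
    "\<And>q. q \<in> X \<Longrightarrow> 3 \<le> length q"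
    "\<And>q q' c. q \<in> X \<Longrightarrow> q' \<in> X \<Longrightarrow> q' = map (\<lambda>k. (c + k) mod m) q \<Longrightarrow> q = q'"
    using long_palindrome_representatives[OF m one less_imp_le[OF se]] by metis
  \<comment> \<open>Of two neighbouring differences one is 1; \<open>Y\<close> collects the possible
    values \<open>y\<close> of the other. The sum \<open>1 + y\<close> separates the orbits of the
    corresponding two-letter factors.\<close>
  define Y where "Y = {y \<in> Zm m. \<exists>i. s \<le> i \<and> Suc i < e \<and> diff m t i + diff m t (Suc i) = 1 + y}"
  have finY: "finite Y" by (rule finite_subset[of _ "Zm m"]) (auto simp: Y_def)
  obtain i where i: "\<And>y. y \<in> Y \<Longrightarrow> s \<le> i y \<and> Suc (i y) < e \<and> diff m t (i y) + diff m t (Suc (i y)) = 1 + y"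
    using bchoice[of Y "\<lambda>y i. s \<le> i \<and> Suc i < e \<and> diff m t i + diff m t (Suc i) = 1 + y"]
    unfolding Y_def by auto
  define h where "h y = map (S m t) [i y..<i y + 2]" for y
  have injh: "y = y'" if y: "y \<in> Y" "y' \<in> Y" and shift: "h y' = map (\<lambda>k. (c + k) mod m) (h y)" for y y' c
  proof -
    have "[1 + y' = 1 + y] (mod m)"
      using shift_diff_sums[OF shift[unfolded h_def], of 0] i[OF y(1)] i[OF y(2)] by simp
    then have "[y' = y] (mod m)" by (simp only: cong_add_lcancel)
    then show ?thesis using y by (simp add: Y_def cong_def)
  qed
  have id: "h y = map (\<lambda>k. (0 + k) mod m) (h y)" for y
    by (simp add: h_def S_def)
  have "inj_on h Y"
    by (rule inj_onI) (metis injh id)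
  have lenh: "length q = 2" if "q \<in> h ` Y" for q using that by (auto simp: h_def)
  have palh: "sublist (h y) ?u \<and> (\<exists>x. Psi m (2 * x) (h y) = h y)" if y: "y \<in> Y" for y
  proof -
    obtain x where x: "[2 * x = S m t (i y) + S m t (Suc (i y))] (mod m)" using even by blast
    have "[S m t n + S m t (i y + (i y + 2) - 1 - n) = 2 * x] (mod m)" if n: "n \<in> {i y..<i y + 2}" for n
    proof -
      from n consider "n = i y" | "n = Suc (i y)" by fastforce
      then show ?thesis using cong_sym[OF x] by cases (simp_all add: add.commute)
    qed
    then have "Psi m (2 * x) (h y) = h y"
      unfolding h_def using m by (intro Psi_map_upt) (auto simp: S_def)
    moreover have "sublist (h y) ?u"
      unfolding h_def using i[OF y] by (intro sublist_map_uptI) auto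
    ultimately show ?thesis by blast
  qed
  \<comment> \<open>The parts contain words of lengths 0, 1, 2 and at least 3. A single letter
    represents length 1, as all letters are translates of each other.\<close>
  let ?Z = "{[], [S m t s]} \<union> h ` Y \<union> X"
  have "card ?Z \<le> card (Pal (Zm m) (I2' m) ?u)"
  proof (rule card_Pal_ge[OF m S_in_Zm[OF m]])
    fix q assume q: "q \<in> ?Z"
    have "sublist [S m t s] ?u"
      using sublist_map_uptI[of s s "Suc s" e "S m t"] se by simp
    moreover have "Psi m (2 * S m t s) [S m t s] = [S m t s]"
      by (simp add: Psi_def S_def)
    moreover have "Psi m (2 * 0) [] = []" by (simp add: Psi_def)
    ultimately show "sublist q ?u \<and> (\<exists>x. Psi m (2 * x) q = q)"
      using q palh X(3) by blast
  next
    fix q q' c assume q: "q \<in> ?Z" "q' \<in> ?Z" and shift: "q' = map (\<lambda>k. (c + k) mod m) q"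
    then have len: "length q' = length q" by simp
    show "q = q'"
    proof (cases "2 \<le> length q")
      case False
      then have "q \<in> {[], [S m t s]}" "q' \<in> {[], [S m t s]}"
        using q len lenh X(4) by fastforce+
      then show ?thesis using len by auto
    next
      case ge: True
      show ?thesis
      proof (cases "length q = 2")
        case True
        then have "q \<in> h ` Y" "q' \<in> h ` Y"
          using q len X(4) by fastforce+
        then obtain y y' where "y \<in> Y" "y' \<in> Y" "q = h y" "q' = h y'" by blast
        with injh[of y y' c] shift show ?thesis by simp
      next
        case False
        then have "q \<in> X" "q' \<in> X"
          using q len lenh ge by auto
        then show ?thesis using shift X(5) by blast
      qed
    qed
  qed
  moreover have "card ?Z = 2 + card Y + card X"
  proof -
    have "({[], [S m t s]} \<union> h ` Y) \<inter> X = {}" using X(4) lenh by fastforce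
    moreover have "length q < 2" if "q \<in> {[], [S m t s]}" for q
      using that by auto
    then have "{[], [S m t s]} \<inter> h ` Y = {}"
      using lenh by (metis disjoint_iff less_irrefl)
    ultimately show ?thesis
      using X(1) finY card_image[OF \<open>inj_on h Y\<close>] by (simp add: card_Un_disjoint)
  qed
  moreover have "card (pals ?d) \<le> card (long_pals ?d) + (2 + card Y)"
  proof -
    have "\<exists>W. finite W \<and> card W \<le> 2 + card Y \<and> pals ?d \<subseteq> long_pals ?d \<union> W"
    proof (cases "Suc s = e")
      \<comment> \<open>A single difference has no neighbour and need not be 1, so it is not covered
        by \<open>Y\<close> and is listed explicitly.\<close>
      case True
      have "pals ?d \<subseteq> {[], [diff m t s]}"
      proof
        fix p assume "p \<in> pals ?d"
        then have "sublist p [diff m t s]" using True by (auto simp: pals_def)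
        then show "p \<in> {[], [diff m t s]}" by (auto simp: sublist_Cons_right prefix_Cons)
      qed
      moreover have "card {[], [diff m t s]} \<le> 2 + card Y" by simp
      ultimately show ?thesis by (intro exI[of _ "{[], [diff m t s]}"]) auto
    next
      case False
      have inY: "y \<in> Y" if "s \<le> i" "Suc i < e" "diff m t i = 1 \<and> diff m t (Suc i) = y
          \<or> diff m t i = y \<and> diff m t (Suc i) = 1" for i y
        using that m by (auto simp: Y_def diff_def)
      \<comment> \<open>A palindrome of length 2 must be \<open>[1, 1]\<close>, since one of its
        equal letters is 1. As \<open>[1]\<close> is listed separately, the index
        \<open>y = 1\<close> is free to account for \<open>[1, 1]\<close>.\<close>
      let ?F = "\<lambda>y. if y = 1 then [1, 1] else [y]" and ?W = "{[], [1]} \<union> (\<lambda>y. if y = 1 then [1, 1] else [y]) ` Y"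
      have "p \<in> ?W" if p: "p \<in> pals ?d" "length p < 3" for p
      proof -
        obtain a b where ab: "s \<le> a" "a \<le> b" "b \<le> e" "p = map (diff m t) [a..<b]"
          using p se by (auto simp: pals_def sublist_map_upt)
        with p(2) consider "b = a" | "b = Suc a" | "b = Suc (Suc a)" by fastforce
        then show ?thesis
        proof cases
          case 1
          then show ?thesis using ab by simp
        next
          case 2
          have p: "p = [diff m t a]" using ab 2 by simp
          have "diff m t a \<in> Y" if ne: "diff m t a \<noteq> 1"
          proof (cases "Suc a < e")
            case True
            then show ?thesis using one(1)[of a] ab ne by (intro inY[of a]) auto
          next
            \<comment> \<open>The last position has no right neighbour inside the factor, so the
              left one is used; it exists because the factor has at least two letters.\<close>
            case last: False
            then obtain a' where "a = Suc a'" "s \<le> a'" using ab 2 False by (cases a) auto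
            then show ?thesis using one(1)[of a'] ab 2 ne by (intro inY[of a']) auto
          qed
          then show ?thesis unfolding p by auto
        next
          case 3
          have pa: "p = [diff m t a, diff m t (Suc a)]" using ab 3 by simp
          have "rev p = p" using p(1) unfolding pals_def by blast
          then have "diff m t (Suc a) = diff m t a"
            unfolding pa rev.simps append.simps list.inject by blast
          with one(1)[of a] have d1: "diff m t a = 1" "diff m t (Suc a) = 1" by simp_all
          have "1 \<in> Y" using ab 3 by (intro inY[of a 1]) (simp_all add: d1)
          then have "?F 1 \<in> ?F ` Y" by (rule imageI)
          then show ?thesis unfolding pa d1 by simp
        qed
      qed
      then have "pals ?d \<subseteq> long_pals ?d \<union> ?W"
        unfolding long_pals_def not_less[symmetric] by blast
      moreover have "card ?W \<le> 2 + card Y"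
        using card_Un_le[of "{[], [1]}" "?F ` Y"] card_image_le[OF finY, of ?F] by simp
      ultimately show ?thesis using finY by (intro exI[of _ ?W]) auto
    qed
    then obtain W where W: "finite W" "card W \<le> 2 + card Y" "pals ?d \<subseteq> long_pals ?d \<union> W" by blast
    then show ?thesis
      using card_Un_le[of "long_pals ?d" W] card_mono[OF _ W(3)] by (simp add: long_pals_def)
  qed
  ultimately show ?thesis using rich X(2) se by (simp add: G_defect_def)
qed

section \<open>The generalized Thue--Morse word\<close>

lemma digit_sum_mult_add:
  assumes "b \<ge> 2" "r < b"
  shows "digit_sum b (b * n + r) = digit_sum b n + r"
proof (cases "b * n + r = 0")
  case True
  then show ?thesis using assms by (simp add: digit_sum.simps[of b 0])
next
  case False
  then show ?thesis using assms by (subst digit_sum.simps) (auto simp: digit_sum.simps[of b 0])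
qed

text \<open>Subtracting 1 turns the \<open>j\<close> trailing zeros into digits \<open>b - 1\<close>
  and lowers the last nonzero digit by 1. The result depends only on \<open>j\<close>, which is the
  Toeplitz property.\<close>

lemma digit_sum_pred:
  assumes b: "b \<ge> 2" and n: "\<not> b dvd n"
  shows "int (digit_sum b (b ^ j * n)) - int (digit_sum b (b ^ j * n - 1)) = 1 - int j * (int b - 1)"
proof (induction j)
  case 0
  have "n mod b \<noteq> 0" using n by (simp add: dvd_eq_mod_eq_0)
  then obtain r where r: "n mod b = Suc r" by (cases "n mod b") auto
  then have "n = b * (n div b) + Suc r" by (metis mult_div_mod_eq)
  moreover have "Suc r < b" using r b by (metis mod_less_divisor zero_less_numeral less_le_trans)
  ultimately show ?case
    using digit_sum_mult_add[OF b, of "Suc r" "n div b"] digit_sum_mult_add[OF b, of r "n div b"]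
    by (metis (no_types, lifting) Suc_lessD add_Suc_right diff_Suc_1 mult_1 mult_zero_left of_nat_0 of_nat_Suc
        power_0 add_diff_cancel_left' diff_zero diff_add_eq_diff_diff_swap add.commute of_nat_add add_diff_cancel_left)
next
  case (Suc j)
  let ?N = "b ^ j * n"
  have "?N > 0" using b n by (cases n) auto
  then have "b ^ Suc j * n - 1 = b * (?N - 1) + (b - 1)" "b ^ Suc j * n = b * ?N + 0"
    using b by (cases ?N; simp add: algebra_simps)+
  then show ?case
    using Suc digit_sum_mult_add[OF b, of "b - 1" "?N - 1"] digit_sum_mult_add[OF b, of 0 "?N"] b
    by (simp add: algebra_simps of_nat_diff)
qed

lemma thue_morse_diff:
  "diff m (thue_morse b m) n = (int (digit_sum b (Suc n)) - int (digit_sum b n)) mod m"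
  by (simp add: diff_def thue_morse_def mod_simps)

lemma thue_morse_diff_eq_1:
  assumes "b \<ge> 2" "m \<ge> 2" "\<not> b dvd Suc n"
  shows "diff m (thue_morse b m) n = 1"
  using digit_sum_pred[OF assms(1,3), of 0] assms(2) by (simp add: thue_morse_diff)

lemma thue_morse_diff_rich:
  assumes b: "b \<ge> 2" and "i \<le> j"
  shows "j - i + 1 \<le> card (pals (map (diff m (thue_morse b m)) [i..<j]))"
proof -
  \<comment> \<open>Shifting the index by one puts the exceptional positions at the multiples of
    \<open>b\<close>; the factors then start at index 1 or later.\<close>
  define f where "f n = (int (digit_sum b n) - int (digit_sum b (n - 1))) mod m" for n
  have "f (b ^ j * n) = f (b ^ j)" if "\<not> b dvd n" for j n
    using digit_sum_pred[OF b that, of j] digit_sum_pred[OF b, of 1 j] b by (simp add: f_def)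
  then have "Suc j - Suc i + 1 \<le> card (pals (map f [Suc i..<Suc j]))"
    using assms by (intro toeplitz_rich[of b]) auto
  moreover have "map f [Suc i..<Suc j] = map (diff m (thue_morse b m)) [i..<j]"
    unfolding map_Suc_upt[symmetric] by (simp add: f_def thue_morse_diff)
  ultimately show ?thesis by simp
qed

text \<open>For odd \<open>b\<close> all powers of \<open>b\<close> are 1 modulo 2.\<close>

lemma even_digit_sum_iff:
  assumes "odd b" "b \<ge> 2"
  shows "even (digit_sum b n) \<longleftrightarrow> even n"
proof (induction n rule: less_induct)
  case (less n)
  show ?case
  proof (cases "n = 0")
    case False
    then have "even (digit_sum b (n div b)) \<longleftrightarrow> even (n div b)"
      using assms by (intro less) simp
    moreover have "digit_sum b n = digit_sum b (n div b) + n mod b"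
      using digit_sum_mult_add[of b "n mod b" "n div b"] assms by simp
    moreover have "even (b * (n div b) + n mod b) \<longleftrightarrow> (even (n div b) \<longleftrightarrow> even (n mod b))"
      using assms by (simp only: even_add even_mult_iff simp_thms)
    ultimately show ?thesis by simp
  qed (simp add: digit_sum.simps)
qed

text \<open>For odd \<open>m\<close> the number 2 is invertible. Otherwise \<open>b\<close> is odd,
  the digit sums of \<open>n\<close> and \<open>n + 2\<close> have equal parity, and that of
  \<open>n + 1\<close> enters twice.\<close>

lemma S_thue_morse_sum_even:
  assumes "odd m \<or> odd b" and b: "b \<ge> 2"
  shows "\<exists>x. [2 * x = S m (thue_morse b m) n + S m (thue_morse b m) (Suc n)] (mod m)"
proof (cases "odd m")
  case True
  then obtain c where c: "m = 2 * c + 1" by (elim oddE)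
  \<comment> \<open>\<open>c + 1\<close> is the inverse of 2 modulo
    \<open>2 * c + 1\<close>.\<close>
  have "2 * ((c + 1) * y) - y = m * y" for y
    by (simp add: c algebra_simps)
  then have "[2 * ((c + 1) * y) = y] (mod m)" for y
    by (simp add: cong_iff_dvd_diff)
  then show ?thesis by blast
next
  case False
  let ?s = "\<lambda>n. int (digit_sum b n)" and ?t = "thue_morse b m"
  have t: "[?t n = ?s n] (mod m)" for n by (simp add: thue_morse_def cong_def)
  have "even (?s n + ?s (Suc (Suc n)))"
    using assms False even_digit_sum_iff[of b] by simp
  then obtain y where y: "?s n + ?s (Suc (Suc n)) = 2 * y" by (elim evenE)
  have "[S m ?t n + S m ?t (Suc n) = (?s n + ?s (Suc n)) + (?s (Suc n) + ?s (Suc (Suc n)))] (mod m)"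
    by (intro cong_add cong_trans[OF S_cong] t)
  also have "(?s n + ?s (Suc n)) + (?s (Suc n) + ?s (Suc (Suc n))) = 2 * (y + ?s (Suc n))"
    using y by simp
  finally show ?thesis by (blast intro: cong_sym)
qed

lemma G_defect_Nil: "m > 0 \<Longrightarrow> G_defect (Zm m) (I2' m) [] = 0"
proof -
  assume m: "m > 0"
  have "G_palindrome (Zm m) (I2' m) []"
    using m by (intro G_palindromeI[of m 0]) (simp_all add: Psi_def)
  then have "Pal (Zm m) (I2' m) [] = {orbit (I2' m) []}" by (auto simp: Pal_def)
  then show ?thesis by (simp add: G_defect_def letter_defect_def)
qed

theorem mainTheorem2:
  fixes m :: int and b :: nat
  assumes "m \<ge> 3" and "b \<ge> 3"
  shows "almost_G_rich (Zm m) (I2' m) (S m (thue_morse b m)) \<and>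
    (odd m \<or> odd b \<longrightarrow> G_rich (Zm m) (I2' m) (S m (thue_morse b m)))"
proof -
  let ?t = "thue_morse b m"
  have m: "m > 0" using assms by simp
  have b: "b \<ge> 2" using assms by simp
  \<comment> \<open>Two multiples of \<open>b\<close> cannot differ by 1 or 2, since
    \<open>b\<close> is at least 3; hence at most one of three consecutive differences deviates from
    1.\<close>
  have "\<not> b dvd Suc n \<or> \<not> b dvd Suc (Suc n)" "\<not> b dvd Suc n \<or> \<not> b dvd Suc (Suc (Suc n))" for n
    using assms(2) dvd_diff_nat[of b "Suc (Suc n)" "Suc n"] dvd_diff_nat[of b "Suc (Suc (Suc n))" "Suc n"]
      dvd_imp_le[of b 1] dvd_imp_le[of b 2] by auto
  then have one: "diff m ?t n = 1 \<or> diff m ?t (Suc n) = 1" "diff m ?t n = 1 \<or> diff m ?t (Suc (Suc n)) = 1" for n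
    using thue_morse_diff_eq_1[OF b, of m] assms(1) by fastforce+
  have rich: "e - s + 1 \<le> card (pals (map (diff m ?t) [s..<e]))" if "s \<le> e" for s e
    using thue_morse_diff_rich[OF b that] .
  have "G_defect_inf (Zm m) (I2' m) (S m ?t) \<le> ereal (real_of_int (int (card {p. set p \<subseteq> Zm m \<and> length p \<le> 2})))"
    unfolding G_defect_inf_def factors_def
    using S_defect_bounded[OF m one _ rich] by (intro SUP_least) fastforce
  then have "almost_G_rich (Zm m) (I2' m) (S m ?t)"
    unfolding almost_G_rich_def by (rule le_less_trans) simp
  moreover have "G_rich (Zm m) (I2' m) (S m ?t)" if odd: "odd m \<or> odd b"
    unfolding G_rich_def
  proof (rule antisym)
    have "G_defect (Zm m) (I2' m) (map (S m ?t) [s..<e]) \<le> 0" if "s \<le> e" for s e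
    proof (cases "s = e")
      case False
      then show ?thesis
        using S_defect_nonpos[OF m one _ rich S_thue_morse_sum_even[OF odd b]] that by simp
    qed (simp add: G_defect_Nil[OF m])
    then show "G_defect_inf (Zm m) (I2' m) (S m ?t) \<le> 0"
      unfolding G_defect_inf_def factors_def by (intro SUP_least) fastforce
    \<comment> \<open>The empty factor has defect 0 and bounds the supremum from below.\<close>
    have "[] \<in> factors (S m ?t)"
      unfolding factors_def by (intro CollectI exI[of _ 0]) simp
    then have "ereal (real_of_int (G_defect (Zm m) (I2' m) [])) \<le> G_defect_inf (Zm m) (I2' m) (S m ?t)"
      unfolding G_defect_inf_def by (rule SUP_upper)
    then show "0 \<le> G_defect_inf (Zm m) (I2' m) (S m ?t)"
      by (simp add: G_defect_Nil[OF m] zero_ereal_def)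
  qed
  ultimately show ?thesis by blast
qed

end
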